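(* Let $p$ be a prime number and let $A$ be a nonempty subset of $\mathbb{Z}/p\mathbb{Z}$. Then the restricted sumset $A\dot{+}A=\{a+b:\ a\in A,\ b\in A,\ a\neq b\}$ satisfies $$|A\dot{+}A|\geqslant \min\{p,\ 2|A|-3\}.$$
   Context: $\mathbb{Z}/p\mathbb{Z}$ is the finite field of integers modulo the prime $p$, and $|S|$ denotes the cardinality of a finite set $S$. The inequality is between integers (the right-hand side may be negative). *)

theory Defs
  imports "HOL-Number_Theory.Residues"
begin

definition restricted_sumset :: "('a, 'm) ring_scheme \<Rightarrow> 'a set \<Rightarrow> 'a set \<Rightarrow> 'a set"
  where "restricted_sumset R A B = {a \<oplus>\<^bsub>R\<^esub> b | a b. a \<in> A \<and> b \<in> B \<and> a \<noteq> b}"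

end

theory Submission
  imports Defs "HOL-Computational_Algebra.Polynomial"
begin

text \<open>
  The polynomial method of Alon, Nathanson and Ruzsa. If \<open>|A| = a + 1\<close>, \<open>|B| = b + 1\<close> and the
  restricted sumset of \<open>A\<close> and \<open>B\<close> lies in a set \<open>C\<close> with \<open>a + b - 1\<close> elements, then
  \<open>(x - y) \<Prod>\<^sub>c (x + y - c)\<close> vanishes on \<open>A \<times> B\<close>. Weights on \<open>A\<close> and \<open>B\<close> whose moments of order
  below \<open>a\<close> resp. \<open>b\<close> vanish, and whose next moments equal \<open>1\<close>, turn summation over \<open>A \<times> B\<close> into
  extraction of the coefficient of \<open>x\<^sup>a y\<^sup>b\<close>; so this coefficient,
  \<open>binom(a + b - 1, a - 1) - binom(a + b - 1, a)\<close>, is zero modulo \<open>p\<close>, which is false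
  for \<open>b < a < p\<close> and \<open>a + b \<le> p\<close>. The theorem is the case \<open>B = A - {z}\<close>.
\<close>

text \<open>The weights are those of the divided difference over \<open>A\<close>; dividing by \<open>x - z\<close> extends
  them from \<open>A - {z}\<close> to \<open>A\<close>.\<close>

lemma exists_moment_weights:
  fixes p :: int
  assumes "prime p" "card A = Suc n" "inj_on (\<lambda>x. x mod p) A"
  shows "\<exists>w. (\<forall>i<n. [(\<Sum>x\<in>A. w x * x ^ i) = 0] (mod p)) \<and> [(\<Sum>x\<in>A. w x * x ^ n) = 1] (mod p)"
  using assms(2,3)
proof (induction n arbitrary: A)
  case 0
  then obtain z where "A = {z}" by (auto simp: card_Suc_eq)
  then show ?case by (intro exI[of _ "\<lambda>_. 1"]) simp
next
  case (Suc n)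
  then obtain z A' where A: "A = insert z A'" "z \<notin> A'" "card A' = Suc n"
    by (metis card_Suc_eq)
  have fin: "finite A'" using A(3) by (intro card_ge_0_finite) simp
  obtain w where w: "\<And>i. i < n \<Longrightarrow> [(\<Sum>x\<in>A'. w x * x ^ i) = 0] (mod p)"
      "[(\<Sum>x\<in>A'. w x * x ^ n) = 1] (mod p)"
    using Suc.IH[of A'] Suc.prems(2) A by auto
  have "\<exists>r. [(x - z) * r = 1] (mod p)" if "x \<in> A'" for x
  proof -
    have "x mod p \<noteq> z mod p"
      using Suc.prems(2) A that by (auto simp: inj_on_def)
    then have "\<not> p dvd x - z" by (simp add: mod_eq_dvd_iff)
    then have "coprime (x - z) p"
      using assms(1) prime_imp_coprime coprime_commute by blast
    then show ?thesis by (rule cong_solve_coprime_int)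
  qed
  then obtain r where r: "\<And>x. x \<in> A' \<Longrightarrow> [(x - z) * r x = 1] (mod p)" by metis
  \<comment> \<open>The value at \<open>z\<close> is chosen to make the moment of order 0 vanish
    exactly.\<close>
  define v where "v x = (if x = z then - (\<Sum>x\<in>A'. w x * r x) else w x * r x)" for x
  define m where "m i = (\<Sum>x\<in>A. v x * x ^ i)" for i
  have sum_A: "(\<Sum>x\<in>A. v x * g x) = (\<Sum>x\<in>A'. w x * r x * g x) - (\<Sum>x\<in>A'. w x * r x) * g z" for g
  proof -
    have "(\<Sum>x\<in>A'. v x * g x) = (\<Sum>x\<in>A'. w x * r x * g x)"
      using A(2) by (intro sum.cong) (auto simp: v_def)
    then show ?thesis using A fin by (simp add: v_def)
  qed
  have m0: "m 0 = 0" using sum_A[of "\<lambda>_. 1"] by (simp add: m_def)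
  \<comment> \<open>The factor \<open>x - z\<close> kills the term at \<open>z\<close> and cancels
    \<open>r x\<close> elsewhere. The recurrence is driven by the moments of \<open>w\<close>, so
    \<open>m\<close> stays 0 up to order \<open>n\<close> and becomes 1 at order
    \<open>Suc n\<close>.\<close>
  have step: "[m (Suc i) = z * m i + (\<Sum>x\<in>A'. w x * x ^ i)] (mod p)" for i
  proof -
    have "m (Suc i) - z * m i = (\<Sum>x\<in>A. v x * ((x - z) * x ^ i))"
      unfolding m_def by (simp add: sum_distrib_left sum_subtractf[symmetric] algebra_simps)
    also have "\<dots> = (\<Sum>x\<in>A'. (w x * x ^ i) * ((x - z) * r x))"
      unfolding sum_A by (simp add: algebra_simps)
    also have "[\<dots> = (\<Sum>x\<in>A'. (w x * x ^ i) * 1)] (mod p)"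
      by (intro cong_sum cong_scalar_left r)
    finally have "[m (Suc i) - z * m i + z * m i = (\<Sum>x\<in>A'. w x * x ^ i) + z * m i] (mod p)"
      by (intro cong_add) auto
    then show ?thesis by (simp add: add.commute)
  qed
  have zero: "[m i = 0] (mod p)" if "i \<le> n" for i
    using that
  proof (induction i)
    case (Suc i)
    then have "[z * m i + (\<Sum>x\<in>A'. w x * x ^ i) = z * 0 + 0] (mod p)"
      by (intro cong_add cong_scalar_left w) auto
    with step[of i] show ?case by (auto dest: cong_trans)
  qed (simp add: m0)
  have "[z * m n + (\<Sum>x\<in>A'. w x * x ^ n) = z * 0 + 1] (mod p)"
    by (intro cong_add cong_scalar_left w zero) auto
  with step[of n] have "[m (Suc n) = 1] (mod p)" by (auto dest: cong_trans)
  with zero show ?case unfolding m_def by (intro exI[of _ v]) auto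
qed

text \<open>The binomial theorem separates the variables. Both products of moments in each term have
  orders adding up to \<open>n + 1\<close>.\<close>

lemma sum_product_binomial_moments:
  fixes w v :: "'a::comm_ring_1 \<Rightarrow> 'a"
  defines "m \<equiv> \<lambda>A w i. \<Sum>x\<in>A. w x * x ^ i"
  shows "(\<Sum>x\<in>A. \<Sum>y\<in>B. w x * v y * ((x - y) * (x + y) ^ n)) =
    (\<Sum>i\<le>n. of_nat (n choose i) * (m A w (Suc i) * m B v (n - i) - m A w i * m B v (Suc (n - i))))"
proof -
  have "(\<Sum>x\<in>A. \<Sum>y\<in>B. w x * v y * ((x - y) * (x + y) ^ n)) =
    (\<Sum>x\<in>A. \<Sum>y\<in>B. \<Sum>i\<le>n. of_nat (n choose i) *
      ((w x * x ^ Suc i) * (v y * y ^ (n - i)) - (w x * x ^ i) * (v y * y ^ Suc (n - i))))"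
    unfolding binomial_ring sum_distrib_left
    by (intro sum.cong refl) (simp add: algebra_simps)
  also have "\<dots> = (\<Sum>i\<le>n. \<Sum>x\<in>A. \<Sum>y\<in>B. of_nat (n choose i) *
      ((w x * x ^ Suc i) * (v y * y ^ (n - i)) - (w x * x ^ i) * (v y * y ^ Suc (n - i))))"
    by (subst sum.swap, subst sum.swap[of _ B]) (rule refl)
  also have "\<dots> = (\<Sum>i\<le>n. of_nat (n choose i) *
      (m A w (Suc i) * m B v (n - i) - m A w i * m B v (Suc (n - i))))"
    unfolding m_def sum_product sum_subtractf[symmetric]
    unfolding sum_distrib_left ..
  finally show ?thesis .
qed

text \<open>By absorption, \<open>a\<close> times the difference is
  \<open>(a - b) * (n choose (a - 1))\<close>. Here \<open>0 < a - b < p\<close>, and the binomial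
  coefficient divides \<open>fact n\<close>, which is prime to \<open>p\<close> as
  \<open>n < p\<close>.\<close>

lemma binomial_difference_not_dvd:
  fixes p a b :: nat
  assumes "prime p" "b < a" "a < p" "Suc n = a + b" "n < p"
  shows "\<not> int p dvd int (n choose (a - 1)) - int (n choose a)"
proof
  assume dvd: "int p dvd int (n choose (a - 1)) - int (n choose a)"
  obtain a' where a': "a = Suc a'" using assms(2) by (cases a) auto
  have n: "n = a' + b" using assms(4) a' by simp
  have "a * (n choose a) = b * (n choose a')"
    using binomial_absorb_comp[of n a'] binomial_absorption[of a' n] a' n
    by simp
  then have "int a * int (n choose a) = int b * int (n choose a')"
    by (metis of_nat_mult)
  then have "int a * (int (n choose (a - 1)) - int (n choose a)) =
      int (a - b) * int (n choose a')"
    using a' assms(2) by (simp add: algebra_simps of_nat_diff)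
  with dvd have "int p dvd int ((a - b) * (n choose a'))"
    by (metis dvd_mult of_nat_mult)
  then have "p dvd (a - b) * (n choose a')" by (simp only: of_nat_dvd_iff)
  moreover have "\<not> p dvd a - b" using assms(2,3) by (auto dest: dvd_imp_le)
  ultimately have "p dvd n choose a'" using assms(1) prime_dvd_mult_nat by blast
  then have "p dvd fact a' * fact (n - a') * (n choose a')" by (rule dvd_mult)
  then have "p dvd fact n" using binomial_fact_lemma[of a' n] n by simp
  then show False using assms(1,5) by (simp add: prime_dvd_fact_iff)
qed

text \<open>Residues are represented by integers, so that polynomials and binomial coefficients live
  in \<open>int\<close> and only congruences involve \<open>p\<close>.\<close>

lemma exists_restricted_sum_avoiding:
  fixes p :: nat and A B C :: "int set"
  assumes "prime p"
    and "card A = Suc a" "inj_on (\<lambda>x. x mod int p) A"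
    and "card B = Suc b" "inj_on (\<lambda>x. x mod int p) B"
    and "b < a" "a < p" "a + b \<le> p"
    and "finite C" "card C < a + b"
  shows "\<exists>x\<in>A. \<exists>y\<in>B. x \<noteq> y \<and> (\<forall>c\<in>C. \<not> [x + y = c] (mod int p))"
proof (rule ccontr)
  assume contra: "\<not> ?thesis"
  have prime: "prime (int p)" using assms(1) by simp
  define n where "n = a + b - 1"
  have n: "Suc n = a + b" using assms(6) by (simp add: n_def)
  obtain w where w: "\<And>i. i < a \<Longrightarrow> [(\<Sum>x\<in>A. w x * x ^ i) = 0] (mod int p)"
      "[(\<Sum>x\<in>A. w x * x ^ a) = 1] (mod int p)"
    using exists_moment_weights[OF prime assms(2,3)] by auto
  obtain v where v: "\<And>i. i < b \<Longrightarrow> [(\<Sum>x\<in>B. v x * x ^ i) = 0] (mod int p)"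
      "[(\<Sum>x\<in>B. v x * x ^ b) = 1] (mod int p)"
    using exists_moment_weights[OF prime assms(4,5)] by auto
  define m m' where "m i = (\<Sum>x\<in>A. w x * x ^ i)" and "m' i = (\<Sum>x\<in>B. v x * x ^ i)" for i
  \<comment> \<open>Moments of order above \<open>a\<close> or \<open>b\<close> are unknown, but the
    bound on \<open>i + j\<close> then puts the other index below its threshold.\<close>
  have mm': "[m i * m' j = (if i = a \<and> j = b then 1 else 0)] (mod int p)" if "i + j \<le> a + b" for i j
  proof -
    have "i < a \<or> j < b \<or> i = a \<and> j = b" using that by arith
    then consider "i < a" | "j < b" | "i = a" "j = b" by blast
    then show ?thesis
    proof cases
      case 1
      then show ?thesis using cong_scalar_right[OF w(1), of i "m' j"] by (simp add: m_def)
    next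
      case 2
      then show ?thesis using cong_scalar_left[OF v(1), of j "m i"] by (simp add: m'_def)
    next
      case 3
      then show ?thesis using cong_mult[OF w(2) v(2)] by (simp add: m_def m'_def)
    qed
  qed
  define S where "S k = (\<Sum>x\<in>A. \<Sum>y\<in>B. w x * v y * ((x - y) * (x + y) ^ k))" for k
  define d where "d i j = (if i = a \<and> j = b then 1 else 0 :: int)" for i j
  have S: "[S k = (\<Sum>i\<le>k. int (k choose i) * (d (Suc i) (k - i) - d i (Suc (k - i))))] (mod int p)"
    if "k \<le> n" for k
    unfolding S_def sum_product_binomial_moments d_def m_def[symmetric] m'_def[symmetric]
    using that n by (intro cong_sum cong_scalar_left cong_diff mm') auto
  \<comment> \<open>The orders add up to \<open>k + 1 < a + b\<close>, so the pair
    \<open>(a, b)\<close> never occurs.\<close>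
  have S_low: "[S k = 0] (mod int p)" if "k < n" for k
  proof -
    have "(\<Sum>i\<le>k. int (k choose i) * (d (Suc i) (k - i) - d i (Suc (k - i)))) = 0"
      using that n by (intro sum.neutral) (auto simp: d_def)
    then show ?thesis using S[of k] that by simp
  qed
  \<comment> \<open>The pair \<open>(a, b)\<close> occurs at \<open>i = a - 1\<close> in the first
    product and at \<open>i = a\<close> in the second. If \<open>b = 0\<close>, the index
    \<open>a\<close> exceeds \<open>n\<close>, but then \<open>n choose a\<close> is 0 as
    well.\<close>
  have S_top: "[S n = int (n choose (a - 1)) - int (n choose a)] (mod int p)"
  proof -
    have "(\<Sum>i\<le>n. int (n choose i) * (d (Suc i) (n - i) - d i (Suc (n - i)))) =
        (\<Sum>i\<le>n. (if i = a - 1 then int (n choose i) else 0) - (if i = a then int (n choose i) else 0))"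
      using n assms(6) by (intro sum.cong refl) (auto simp: d_def)
    also have "\<dots> = int (n choose (a - 1)) - int (n choose a)"
    proof -
      have "a - Suc 0 \<le> n" using n assms(6) by linarith
      then show ?thesis by (simp add: sum_subtractf binomial_eq_0)
    qed
    finally show ?thesis using S[of n] by simp
  qed
  \<comment> \<open>The monomial raises the degree to exactly \<open>n\<close> when \<open>C\<close>
    has fewer than \<open>n\<close> elements. As \<open>Q\<close> is monic, its lower terms
    contribute only multiples of \<open>S i\<close> with \<open>i < n\<close>, all zero mod
    \<open>p\<close>.\<close>
  define Q where "Q = (\<Prod>c\<in>C. [:- c, 1:]) * monom (1 :: int) (n - card C)"
  have mon: "lead_coeff (\<Prod>c\<in>C. [:- c, 1 :: int:]) = 1" unfolding lead_coeff_prod by simp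
  have "degree (\<Prod>c\<in>C. [:- c, 1 :: int:]) = card C"
    by (subst degree_prod_eq_sum_degree) auto
  moreover have "(\<Prod>c\<in>C. [:- c, 1 :: int:]) \<noteq> 0" using assms(9) by simp
  ultimately have deg: "degree Q = n"
    using assms(10) n unfolding Q_def
    by (subst degree_mult_eq) (auto simp: degree_monom_eq monom_eq_0_iff)
  have lead: "coeff Q n = 1"
    using mon deg unfolding Q_def by (metis lead_coeff_mult lead_coeff_monom mult_1)
  have poly_Q: "poly Q s = s ^ n + (\<Sum>i<n. coeff Q i * s ^ i)" for s
    unfolding poly_altdef deg by (simp add: lead lessThan_Suc_atMost[symmetric])
  have "[(\<Sum>x\<in>A. \<Sum>y\<in>B. w x * v y * ((x - y) * poly Q (x + y))) = (\<Sum>x\<in>A. \<Sum>y\<in>B. 0)] (mod int p)"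
  proof (intro cong_sum)
    fix x y assume xy: "x \<in> A" "y \<in> B"
    show "[w x * v y * ((x - y) * poly Q (x + y)) = 0] (mod int p)"
    proof (cases "x = y")
      case False
      with contra xy obtain c where c: "c \<in> C" "[x + y = c] (mod int p)" by auto
      then have "int p dvd poly [:- c, 1:] (x + y)"
        by (simp add: cong_iff_dvd_diff algebra_simps)
      also have "\<dots> dvd (\<Prod>c\<in>C. poly [:- c, 1:] (x + y))"
        using c(1) assms(9) by (rule dvd_prodI[rotated])
      finally have "int p dvd poly Q (x + y)" by (simp add: Q_def poly_prod)
      then show ?thesis by (simp add: cong_0_iff)
    qed simp
  qed
  also have "(\<Sum>x\<in>A. \<Sum>y\<in>B. w x * v y * ((x - y) * poly Q (x + y))) =
      S n + (\<Sum>i<n. coeff Q i * S i)"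
  proof -
    have "(\<Sum>i<n. coeff Q i * S i) =
        (\<Sum>x\<in>A. \<Sum>i<n. \<Sum>y\<in>B. coeff Q i * (w x * v y * ((x - y) * (x + y) ^ i)))"
      unfolding S_def sum_distrib_left by (rule sum.swap)
    also have "\<dots> = (\<Sum>x\<in>A. \<Sum>y\<in>B. \<Sum>i<n. coeff Q i * (w x * v y * ((x - y) * (x + y) ^ i)))"
      by (intro sum.cong refl sum.swap)
    finally show ?thesis
      unfolding S_def poly_Q
      by (simp add: sum.distrib[symmetric] sum_distrib_left algebra_simps)
  qed
  finally have "[S n + (\<Sum>i<n. coeff Q i * S i) = 0] (mod int p)" by simp
  moreover have "[(\<Sum>i<n. coeff Q i * S i) = (\<Sum>i<n. coeff Q i * 0)] (mod int p)"
    by (intro cong_sum cong_scalar_left S_low) simp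
  ultimately have "[S n = 0] (mod int p)"
    by (simp add: cong_0_iff dvd_add_left_iff)
  with S_top have "int p dvd int (n choose (a - 1)) - int (n choose a)"
    by (meson cong_0_iff cong_sym cong_trans)
  moreover have "n < p" using n assms(8) by linarith
  ultimately show False using binomial_difference_not_dvd[OF assms(1,6,7) n] by blast
qed

text \<open>Pairing \<open>A\<close> with \<open>A - {z}\<close> gives \<open>a = k + 1\<close> and
  \<open>b = k\<close>. Pairing \<open>A\<close> with itself would fail: for \<open>a = b\<close>
  the two binomial coefficients coincide by symmetry.\<close>

lemma card_restricted_sumset_residue_ring:
  fixes p :: nat and A :: "int set"
  assumes "prime p" and A: "A \<subseteq> carrier (residue_ring (int p))"
    and "card A = k + 2" "2 * k < p"
  shows "2 * k < card (restricted_sumset (residue_ring (int p)) A A)"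
proof (rule ccontr)
  let ?C = "restricted_sumset (residue_ring (int p)) A A"
  assume "\<not> ?thesis"
  then have card_C: "card ?C < Suc k + k" by simp
  have C: "?C = {(x + y) mod int p | x y. x \<in> A \<and> y \<in> A \<and> x \<noteq> y}"
    by (simp add: restricted_sumset_def residue_ring_def)
  have A_bounds: "A \<subseteq> {0..int p - 1}" using A by (simp add: residue_ring_def)
  have mod_id: "x mod int p = x" if "x \<in> A" for x
    using that A_bounds by (intro mod_pos_pos_trivial) auto
  have "inj_on (\<lambda>x. x mod int p) A"
    by (intro inj_onI) (simp add: mod_id)
  moreover obtain z where z: "z \<in> A" using assms(3) by fastforce
  moreover have "card (A - {z}) = Suc k" using z assms(3) by simp
  moreover have "?C \<subseteq> {0..<int p}"
    unfolding C using prime_gt_0_nat[OF assms(1)] by auto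
  then have "finite ?C" by (rule finite_subset) simp
  moreover have "Suc k < p"
    using assms(4) prime_ge_2_nat[OF assms(1)] by (cases "k = 0") auto
  ultimately have "\<exists>x\<in>A. \<exists>y\<in>A - {z}. x \<noteq> y \<and> (\<forall>c\<in>?C. \<not> [x + y = c] (mod int p))"
    using assms card_C
    by (intro exists_restricted_sum_avoiding[where a = "Suc k" and b = k])
       (auto intro: inj_on_subset)
  then obtain x y where xy: "x \<in> A" "y \<in> A" "x \<noteq> y"
      and avoid: "\<And>c. c \<in> ?C \<Longrightarrow> \<not> [x + y = c] (mod int p)"
    by blast
  have "(x + y) mod int p \<in> ?C" using xy unfolding C by blast
  from avoid[OF this] show False by (simp add: cong_def)
qed

theorem corollary3p1:
  fixes p :: nat and A :: "int set"
  assumes "prime p"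
    and "A \<subseteq> carrier (residue_ring (int p))"
    and "A \<noteq> {}"
  shows "int (card (restricted_sumset (residue_ring (int p)) A A))
           \<ge> min (int p) (2 * int (card A) - 3)"
proof (cases "card A < 2")
  case False
  \<comment> \<open>Shrinking \<open>A\<close> to \<open>k + 2\<close> elements ensures
    \<open>2 * k < p\<close>. For odd \<open>p\<close>, \<open>2 * k + 1\<close> is exactly the
    minimum in the claim.\<close>
  define k where "k = min (card A - 2) ((p - 1) div 2)"
  have p: "p \<ge> 2" using assms(1) by (rule prime_ge_2_nat)
  have A_bounds: "A \<subseteq> {0..int p - 1}" using assms(2) by (simp add: residue_ring_def)
  have card_A: "card A \<le> p" using card_mono[OF _ A_bounds] by simp
  have "k + 2 \<le> card A" using False by (simp add: k_def)
  then obtain A' where A': "A' \<subseteq> A" "card A' = k + 2"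
    by (meson obtain_subset_with_card_n)
  have "2 * k < p" using p by (simp add: k_def min_def) linarith
  then have "2 * k < card (restricted_sumset (residue_ring (int p)) A' A')"
    using A' assms(1,2) by (intro card_restricted_sumset_residue_ring) auto
  also have "\<dots> \<le> card (restricted_sumset (residue_ring (int p)) A A)"
  proof (rule card_mono)
    have "finite A" using False by (intro card_ge_0_finite) simp
    then have "finite ((\<lambda>(a, b). a \<oplus>\<^bsub>residue_ring (int p)\<^esub> b) ` (A \<times> A))" by simp
    then show "finite (restricted_sumset (residue_ring (int p)) A A)"
      by (rule finite_subset[rotated]) (auto simp: restricted_sumset_def)
  qed (use A' in \<open>auto simp: restricted_sumset_def\<close>)
  finally have lower: "2 * k < card (restricted_sumset (residue_ring (int p)) A A)" .
  have "min (int p) (2 * int (card A) - 3) \<le> 2 * int k + 1"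
  proof (cases "p = 2")
    case True
    \<comment> \<open>Here \<open>k = 0\<close>, and \<open>card A \<le> 2\<close> bounds the
      minimum by 1.\<close>
    then show ?thesis using card_A by simp
  next
    case False
    then have "odd p" using assms(1) p prime_odd_nat by auto
    then show ?thesis using \<open>\<not> card A < 2\<close> by (auto simp: k_def min_def elim!: oddE)
  qed
  with lower show ?thesis by linarith
\<comment> \<open>With fewer than two elements the right-hand side is negative.\<close>
qed auto

end
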